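(* Let $T : G \curvearrowright X$ be a continuous action of a locally compact unimodular topological group $G$ on a compact pseudometric space $(X, p)$, let $\mu$ be a regular Borel probability measure on $X$, and let $(F_i)_{i \in \mathscr{I}}$ be a net of compact subsets of $G$ with positive Haar measure. Let $H, L : G \to (0, \infty)$ be measurable functions such that $$p(T_g x, T_g y) \leq L(g) \cdot p(x, y)^{H(g)} \qquad (\forall g \in G,\ x \in X,\ y \in X).$$ Suppose that for each $x \in X$, $(C_i(x))_{i \in \mathscr{I}}$ is a net of measurable subsets of $X$ containing the point $x$ such that $\mu(C_i(x)) > 0$, and that for $\mu$-almost all $x \in X$ we have $$\lim_i \frac{m\left( \left\{ g \in F_i : L(g) \cdot \operatorname{diam}(C_i(x))^{H(g)} > \delta \right\} \right)}{m(F_i)} = 0$$ for all $\delta > 0$. Let $f : X \to \mathbb{C}$ be a continuous function, and suppose that for $\mu$-almost all $x \in X$ we have $\lim_i \operatorname{Avg}_{F_i} f(x) = f^*(x)$, where $f^*$ is a measurable function $X \to \mathbb{C}$. Then $$\lim_i \alpha_{C_i(x)}\left( \operatorname{Avg}_{F_i} f \right) = f^*(x)$$ for $\mu$-almost all $x \in X$.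
   Context: $m$ denotes a (bi-invariant) Haar measure on $G$. For a compact $K \subseteq G$ with $m(K)>0$ and $f \in C(X)$, $\operatorname{Avg}_K f(x) = \frac{1}{m(K)} \int_K f(T_g x) \, \mathrm{d}m(g)$, a continuous function on $X$. For a measurable $C \subseteq X$ with $\mu(C)>0$, $\alpha_C(h) = \frac{1}{\mu(C)} \int_C h \, \mathrm{d}\mu$. $\operatorname{diam}(C) = \sup_{x,y \in C} p(x,y)$. "For almost all $x$" means outside a $\mu$-null set. The measure $\mu$ is not assumed to be $T$-invariant. *)

theory Defs
  imports "HOL-Probability.Probability"
begin

section \<open>Nets\<close>

definition directed_preorder :: "('i \<Rightarrow> 'i \<Rightarrow> bool) \<Rightarrow> bool" where
  "directed_preorder le \<longleftrightarrow> reflp le \<and> transp le \<and> (\<forall>i j. \<exists>k. le i k \<and> le j k)"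

text \<open>The filter of tails of the directed index set; \<open>(f \<longlongrightarrow> l) (net_filter le)\<close> is convergence of
  the net \<open>f\<close> to \<open>l\<close>. Unlike \<^const>\<open>at_top\<close>, it does not require the preorder to be
  antisymmetric.\<close>

definition net_filter :: "('i \<Rightarrow> 'i \<Rightarrow> bool) \<Rightarrow> 'i filter" where
  "net_filter le = (\<Sqinter>i. principal {j. le i j})"

lemma eventually_net_filter:
  assumes "directed_preorder le"
  shows "eventually P (net_filter le) \<longleftrightarrow> (\<exists>i. \<forall>j. le i j \<longrightarrow> P j)"
  unfolding net_filter_def
proof (subst eventually_INF_base)
  fix a b :: 'a
  obtain k where "le a k" "le b k"
    using assms by (auto simp: directed_preorder_def)
  then have "{j. le k j} \<subseteq> {j. le a j} \<inter> {j. le b j}"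
    using assms by (auto simp: directed_preorder_def dest: transpD)
  then show "\<exists>x\<in>UNIV. principal {j. le x j} \<le> inf (principal {j. le a j}) (principal {j. le b j})"
    by auto
qed (auto simp: eventually_principal)

section \<open>Compact pseudometric spaces\<close>

text \<open>The space is the whole type, and its topology is required to be the one generated by the
  open \<open>p\<close>-balls. No separation axiom is imposed on the type.\<close>

definition pseudometric :: "('x \<Rightarrow> 'x \<Rightarrow> real) \<Rightarrow> bool" where
  "pseudometric p \<longleftrightarrow>
     (\<forall>x y. 0 \<le> p x y) \<and> (\<forall>x. p x x = 0) \<and> (\<forall>x y. p x y = p y x) \<and>
     (\<forall>x y z. p x z \<le> p x y + p y z)"

definition compact_pseudometric_space :: "('x::topological_space \<Rightarrow> 'x \<Rightarrow> real) \<Rightarrow> bool" where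
  "compact_pseudometric_space p \<longleftrightarrow>
     pseudometric p \<and>
     (\<forall>U::'x set. open U \<longleftrightarrow> (\<forall>x\<in>U. \<exists>e>0. \<forall>y. p x y < e \<longrightarrow> y \<in> U)) \<and>
     compact (UNIV :: 'x set)"

definition pdiam :: "('x \<Rightarrow> 'x \<Rightarrow> real) \<Rightarrow> 'x set \<Rightarrow> real" where
  "pdiam p C = (SUP (x, y)\<in>C \<times> C. p x y)"

section \<open>Measures\<close>

definition regular_borel_measure :: "'x::topological_space measure \<Rightarrow> bool" where
  "regular_borel_measure \<mu> \<longleftrightarrow>
     sets \<mu> = sets borel \<and>
     (\<forall>A\<in>sets borel. emeasure \<mu> A = (INF U\<in>{U. open U \<and> A \<subseteq> U}. emeasure \<mu> U)) \<and>
     (\<forall>A\<in>sets borel. emeasure \<mu> A = (SUP K\<in>{K. compact K \<and> K \<subseteq> A}. emeasure \<mu> K))"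

text \<open>Topological groups are written additively, as in the class \<^class>\<open>topological_group_add\<close>;
  its addition is not assumed commutative. The Hausdorff property is not assumed. If it fails, a
  compact set need not be Borel; non-Borel sets have \<^const>\<open>emeasure\<close> 0, so a compact set of
  positive measure is always Borel.\<close>

definition left_haar_measure :: "'g::topological_group_add measure \<Rightarrow> bool" where
  "left_haar_measure m \<longleftrightarrow>
     sets m = sets borel \<and>
     emeasure m UNIV \<noteq> 0 \<and>
     (\<forall>K. compact K \<longrightarrow> emeasure m K < \<infinity>) \<and>
     (\<forall>A\<in>sets borel. emeasure m A = (INF U\<in>{U. open U \<and> A \<subseteq> U}. emeasure m U)) \<and>
     (\<forall>U. open U \<longrightarrow> emeasure m U = (SUP K\<in>{K. compact K \<and> K \<subseteq> U}. emeasure m K)) \<and>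
     (\<forall>g. \<forall>A\<in>sets borel. emeasure m ((\<lambda>h. g + h) ` A) = emeasure m A)"

definition right_invariant :: "'g::topological_group_add measure \<Rightarrow> bool" where
  "right_invariant m \<longleftrightarrow> (\<forall>g. \<forall>A\<in>sets borel. emeasure m ((\<lambda>h. h + g) ` A) = emeasure m A)"

definition bi_invariant_haar_measure :: "'g::topological_group_add measure \<Rightarrow> bool" where
  "bi_invariant_haar_measure m \<longleftrightarrow> left_haar_measure m \<and> right_invariant m"

definition unimodular :: "'g::topological_group_add itself \<Rightarrow> bool" where
  "unimodular _ \<longleftrightarrow> (\<forall>m::'g measure. left_haar_measure m \<longrightarrow> right_invariant m)"

section \<open>Actions and averages\<close>

definition continuous_action ::
    "('g::topological_group_add \<Rightarrow> 'x::topological_space \<Rightarrow> 'x) \<Rightarrow> bool" where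
  "continuous_action T \<longleftrightarrow>
     (\<forall>x. T 0 x = x) \<and> (\<forall>g h x. T (g + h) x = T g (T h x)) \<and>
     continuous_on UNIV (\<lambda>(g, x). T g x)"

definition Avg :: "'g measure \<Rightarrow> ('g \<Rightarrow> 'x \<Rightarrow> 'x) \<Rightarrow> 'g set \<Rightarrow> ('x \<Rightarrow> complex) \<Rightarrow> 'x \<Rightarrow> complex" where
  "Avg m T K f x = (1 / measure m K) *\<^sub>R (LINT g:K|m. f (T g x))"

definition set_mean :: "'x measure \<Rightarrow> 'x set \<Rightarrow> ('x \<Rightarrow> complex) \<Rightarrow> complex" where
  "set_mean \<mu> C h = (1 / measure \<mu> C) *\<^sub>R (LINT x:C|\<mu>. h x)"

end

theory Submission
  imports Defs
begin

text \<open>If \<open>y \<in> C i x\<close> and \<open>g \<in> F i\<close> lies outside the exceptional set for \<open>\<delta>\<close>, then the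
  Hoelder bound gives \<open>p (T g y) (T g x) \<le> \<delta>\<close>, so uniform continuity makes \<open>f (T g y)\<close>
  and \<open>f (T g x)\<close> close. On the exceptional set, of asymptotically negligible proportion, the
  difference is bounded by twice the sup norm of \<open>f\<close>. Hence the ergodic average over \<open>F i\<close>
  oscillates by at most \<open>o(1)\<close> on \<open>C i x\<close>, and its mean over \<open>C i x\<close> differs by \<open>o(1)\<close> from
  its value at \<open>x\<close>.\<close>

section \<open>Compactness arguments for a pseudometric\<close>

lemma open_pball:
  assumes "compact_pseudometric_space p"
  shows "open {y. p x y < r}"
proof -
  have tri: "p x z \<le> p x y + p y z" for x y z
    using assms by (auto simp: compact_pseudometric_space_def pseudometric_def)
  have "\<exists>e>0. \<forall>z. p y z < e \<longrightarrow> p x z < r" if "p x y < r" for y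
    using that by (intro exI[of _ "r - p x y"])
      (auto simp: less_diff_eq add.commute intro: le_less_trans[OF tri[of x _ y]])
  then show ?thesis
    using assms unfolding compact_pseudometric_space_def by auto
qed

text \<open>The radius may vary with the centre: constant radius 1 yields boundedness of
  \<open>p\<close>, and a radius adapted to a function yields uniform continuity.\<close>

lemma compact_pseudometric_space_finite_cover:
  fixes p :: "'x::topological_space \<Rightarrow> 'x \<Rightarrow> real"
  assumes "compact_pseudometric_space p" and "\<And>x. 0 < r x"
  obtains A where "finite A" "\<And>y. \<exists>a\<in>A. p a y < r a"
proof -
  have "compact (UNIV :: 'x set)" and "\<And>x. p x x = 0"
    using assms(1) by (auto simp: compact_pseudometric_space_def pseudometric_def)
  then have "UNIV \<subseteq> (\<Union>a\<in>UNIV. {y. p a y < r a})"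
    using assms(2) by (metis (mono_tags, lifting) UNIV_I UN_iff mem_Collect_eq subsetI)
  from compactE_image[OF \<open>compact UNIV\<close> open_pball[OF assms(1)] this] obtain A where
    "finite A" "UNIV \<subseteq> (\<Union>a\<in>A. {y. p a y < r a})"
    by metis
  with that show ?thesis by blast
qed

text \<open>Ensures that the real supremum in \<open>pdiam\<close> is taken over a set bounded
  above, so that it really dominates the distances.\<close>

lemma compact_pseudometric_space_bounded:
  assumes "compact_pseudometric_space p"
  obtains B where "\<And>x y. p x y \<le> B"
proof -
  have tri: "p x z \<le> p x y + p y z" and sym: "p x y = p y x" and nn: "0 \<le> p x y" for x y z
    using assms by (auto simp: compact_pseudometric_space_def pseudometric_def)
  obtain A where A: "finite A" "\<And>y. \<exists>a\<in>A. p a y < 1"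
    using compact_pseudometric_space_finite_cover[OF assms, of "\<lambda>_. 1"] by auto
  \<comment> \<open>Pass from \<open>x\<close> to \<open>y\<close> through nearby centres
    \<open>a\<close> and \<open>b\<close>: the two short legs cost less than 2, and the double sum
    dominates every \<open>p a b\<close>.\<close>
  have "p x y \<le> (\<Sum>a\<in>A. \<Sum>b\<in>A. p a b) + 2" for x y
  proof -
    obtain a b where ab: "a \<in> A" "p a x < 1" "b \<in> A" "p b y < 1"
      using A(2) by blast
    have "p a b \<le> (\<Sum>b\<in>A. p a b)"
      using A(1) ab nn by (intro member_le_sum) auto
    also have "\<dots> \<le> (\<Sum>a\<in>A. \<Sum>b\<in>A. p a b)"
      using A(1) ab nn by (intro member_le_sum[of a A "\<lambda>a. \<Sum>b\<in>A. p a b"] sum_nonneg) auto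
    finally show ?thesis
      using tri[of x y a] tri[of a y b] sym[of x a] ab by linarith
  qed
  with that show ?thesis by blast
qed

lemma dist_le_pdiam:
  assumes "compact_pseudometric_space p" "x \<in> C" "y \<in> C"
  shows "p x y \<le> pdiam p C"
proof -
  obtain B where "\<And>x y. p x y \<le> B"
    using compact_pseudometric_space_bounded[OF assms(1)] by blast
  then have "bdd_above ((\<lambda>(x, y). p x y) ` (C \<times> C))"
    by (intro bdd_aboveI[of _ B]) auto
  then have "(\<lambda>(x, y). p x y) (x, y) \<le> pdiam p C"
    unfolding pdiam_def using assms by (intro cSUP_upper) auto
  then show ?thesis by simp
qed

text \<open>A Lebesgue number argument. It never separates points, so distinct points at distance 0
  do no harm.\<close>

lemma compact_pseudometric_space_uniformly_continuous:
  fixes f :: "'x::topological_space \<Rightarrow> 'b::metric_space"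
  assumes p: "compact_pseudometric_space p" and f: "continuous_on UNIV f" and "0 < e"
  obtains d where "0 < d" "\<And>x y. p x y < d \<Longrightarrow> dist (f x) (f y) < e"
proof -
  have tri: "p x z \<le> p x y + p y z" and sym: "p x y = p y x" and refl: "p x x = 0" for x y z
    using p by (auto simp: compact_pseudometric_space_def pseudometric_def)
  \<comment> \<open>The factor 2 leaves room: if \<open>x\<close> is within \<open>d a\<close> of a
    centre \<open>a\<close> and \<open>p x y < d a\<close>, then \<open>y\<close> is still in the
    double ball around \<open>a\<close>.\<close>
  have "\<exists>d>0. \<forall>y. p x y < 2 * d \<longrightarrow> dist (f x) (f y) < e / 2" for x
  proof -
    have "open (f -` ball (f x) (e / 2))"
      using f by (intro open_vimage) auto
    moreover have "x \<in> f -` ball (f x) (e / 2)"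
      using \<open>0 < e\<close> by simp
    ultimately obtain d where "0 < d" "\<forall>y. p x y < d \<longrightarrow> y \<in> f -` ball (f x) (e / 2)"
      using p unfolding compact_pseudometric_space_def by blast
    then show ?thesis
      by (intro exI[of _ "d / 2"]) auto
  qed
  then obtain d where d: "\<And>x. 0 < d x"
    "\<And>x y. p x y < 2 * d x \<Longrightarrow> dist (f x) (f y) < e / 2"
    by metis
  obtain A where A: "finite A" "\<And>y. \<exists>a\<in>A. p a y < d a"
    using compact_pseudometric_space_finite_cover[OF p, of d] d(1) by auto
  have "A \<noteq> {}"
    using A(2) by auto
  show ?thesis
  proof
    show "0 < Min (d ` A)"
      using A(1) \<open>A \<noteq> {}\<close> d(1) by simp
    fix x y assume xy: "p x y < Min (d ` A)"
    obtain a where a: "a \<in> A" "p a x < d a"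
      using A(2) by blast
    have "p x y < d a"
      using less_le_trans[OF xy Min_le] a A(1) by simp
    then have "dist (f a) (f x) < e / 2" "dist (f a) (f y) < e / 2"
      using d(2)[of a x] d(2)[of a y] d(1)[of a] a tri[of a y x] by linarith+
    then show "dist (f x) (f y) < e"
      by (rule dist_triangle_half_r)
  qed
qed

section \<open>Estimates and continuity for means over a set\<close>

text \<open>The exceptional set \<open>B\<close> contributes only in proportion to its share of
  \<open>A\<close>. Time averages use this with a genuine \<open>B\<close>; taking \<open>B\<close>
  empty removes the \<open>K\<close> term and gives plain uniform estimates.\<close>

lemma norm_set_mean_diff_le:
  assumes A: "A \<in> sets M" "0 < emeasure M A" "emeasure M A < \<infinity>"
    and u: "set_integrable M A u" and v: "set_integrable M A v"
    and B: "B \<in> sets M" "B \<subseteq> A"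
    and good: "\<And>x. x \<in> A - B \<Longrightarrow> norm (u x - v x) \<le> e"
    and bad: "\<And>x. x \<in> B \<Longrightarrow> norm (u x - v x) \<le> K" and "0 \<le> e"
  shows "norm (set_mean M A u - set_mean M A v) \<le> e + K * (measure M B / measure M A)"
proof -
  \<comment> \<open>Finiteness matters here, since \<open>measure\<close> assigns 0 to sets of
    infinite measure.\<close>
  have pos: "0 < measure M A"
    using A by (simp add: measure_def enn2real_positive_iff top.not_eq_extremum)
  have Bfin: "emeasure M B < \<infinity>"
    using emeasure_mono[OF B(2) A(1)] A(3) by (rule le_less_trans)
  have int: "set_integrable M A (\<lambda>x. u x - v x)"
    using u v by simp
  have "norm (LINT x:A|M. u x - v x) \<le> (LINT x:A|M. norm (u x - v x))"
    using int by (rule set_integral_norm_bound)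
  \<comment> \<open>On \<open>B\<close> the majorant is \<open>e + K\<close>, which is large enough
    because \<open>0 \<le> e\<close>.\<close>
  also have "\<dots> \<le> (LINT x|M. indicator A x * e + indicator B x * K)"
    unfolding set_lebesgue_integral_def
  proof (rule integral_mono)
    show "integrable M (\<lambda>x. indicator A x *\<^sub>R norm (u x - v x))"
      using set_integrable_norm[OF int] by (simp add: set_integrable_def)
    show "integrable M (\<lambda>x. indicator A x * e + indicator B x * K)"
      using A B Bfin by (intro Bochner_Integration.integrable_add integrable_mult_left) auto
    fix x
    show "indicator A x *\<^sub>R norm (u x - v x) \<le> indicator A x * e + indicator B x * K"
      using good[of x] bad[of x] B(2) \<open>0 \<le> e\<close> by (auto simp: indicator_def)
  qed
  also have "\<dots> = e * measure M A + K * measure M B"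
    using A B Bfin by (subst Bochner_Integration.integral_add) auto
  finally have le: "norm (LINT x:A|M. u x - v x) \<le> e * measure M A + K * measure M B" .
  have "norm (set_mean M A u - set_mean M A v) = norm (LINT x:A|M. u x - v x) / measure M A"
    using u v pos by (simp add: set_mean_def flip: scaleR_diff_right)
  also have "\<dots> \<le> (e * measure M A + K * measure M B) / measure M A"
    using le pos by (simp add: divide_right_mono)
  also have "\<dots> = e + K * (measure M B / measure M A)"
    using pos by (simp add: field_simps)
  finally show ?thesis .
qed

lemma norm_set_mean_diff_const_le:
  assumes A: "A \<in> sets M" "0 < emeasure M A" "emeasure M A < \<infinity>"
    and u: "set_integrable M A u" and le: "\<And>x. x \<in> A \<Longrightarrow> norm (u x - c) \<le> e" and "0 \<le> e"
  shows "norm (set_mean M A u - c) \<le> e"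
proof -
  have pos: "0 < measure M A"
    using A by (simp add: measure_def enn2real_positive_iff top.not_eq_extremum)
  have "set_integrable M A (\<lambda>_. c)"
    using A by (auto simp: set_integrable_def)
  then have "norm (set_mean M A u - set_mean M A (\<lambda>_. c)) \<le> e + 0 * (measure M {} / measure M A)"
    using assms by (intro norm_set_mean_diff_le) auto
  moreover have "set_mean M A (\<lambda>_. c) = c"
    using A pos by (simp add: set_mean_def set_lebesgue_integral_def)
  ultimately show ?thesis by simp
qed

lemma set_integrable_continuous_bounded:
  fixes f :: "'x::topological_space \<Rightarrow> 'b::{banach, second_countable_topology}"
  assumes "sets M = sets borel" "A \<in> sets M" "emeasure M A < \<infinity>"
    and "continuous_on UNIV f" and "\<And>x. norm (f x) \<le> K"
  shows "set_integrable M A f"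
  unfolding set_integrable_def
proof (rule integrableI_bounded_set_indicator)
  show "f \<in> borel_measurable M"
    using borel_measurable_continuous_onI[OF assms(4)]
    by (simp add: measurable_cong_sets[OF assms(1) refl])
qed (use assms in auto)

text \<open>By compactness of \<open>A\<close>, \<open>h y g\<close> is close to
  \<open>h x g\<close> uniformly in \<open>g\<close> once \<open>y\<close> is near \<open>x\<close>.
  The continuity obtained makes the time averages measurable, hence integrable over each
  \<open>C i x\<close>.\<close>

lemma continuous_on_set_mean:
  fixes h :: "'x::topological_space \<Rightarrow> 'g::topological_space \<Rightarrow> complex"
  assumes M: "sets M = sets borel" and A: "A \<in> sets M" "0 < emeasure M A" "emeasure M A < \<infinity>"
    and "compact A" and h: "continuous_on UNIV (\<lambda>(x, g). h x g)"
    and bnd: "\<And>x g. norm (h x g) \<le> K"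
  shows "continuous_on UNIV (\<lambda>x. set_mean M A (h x))"
proof -
  have cont: "continuous_on UNIV (h x)" for x
    using continuous_on_compose2[OF h continuous_on_Pair[OF continuous_on_const continuous_on_id]]
    by simp
  have int: "set_integrable M A (h x)" for x
    by (rule set_integrable_continuous_bounded[OF M A(1,3) cont bnd])
  show ?thesis
    unfolding continuous_on_def
  proof (intro ballI tendstoI)
    fix x and e :: real assume "0 < e"
    then have "0 < e / 2" by simp
    have "continuous_on (UNIV \<times> A) (\<lambda>(x, g). h x g)"
      using h by (rule continuous_on_subset) auto
    from continuous_on_prod_compactE[OF this \<open>compact A\<close> UNIV_I \<open>0 < e / 2\<close>, of x]
    obtain U where U: "x \<in> U" "open U" and close: "\<forall>y\<in>U \<inter> UNIV. \<forall>g\<in>A. dist (h y g) (h x g) \<le> e / 2"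
      by (auto simp: split_beta)
    have "dist (set_mean M A (h y)) (set_mean M A (h x)) < e" if "y \<in> U" for y
    proof -
      have "norm (set_mean M A (h y) - set_mean M A (h x))
          \<le> e / 2 + 0 * (measure M {} / measure M A)"
        using A int close that \<open>0 < e\<close>
        by (intro norm_set_mean_diff_le) (auto simp: dist_norm)
      then show ?thesis
        using \<open>0 < e\<close> by (simp add: dist_norm)
    qed
    then show "\<forall>\<^sub>F y in at x within UNIV. dist (set_mean M A (h y)) (set_mean M A (h x)) < e"
      using U by (auto simp: eventually_at_topological)
  qed
qed

section \<open>Comparison of spatial and pointwise limits of time averages\<close>

theorem corollary3p7:
  fixes T :: "'g::topological_group_add \<Rightarrow> 'x::topological_space \<Rightarrow> 'x"
    and p :: "'x \<Rightarrow> 'x \<Rightarrow> real"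
    and m :: "'g measure"
    and \<mu> :: "'x measure"
    and le :: "'i \<Rightarrow> 'i \<Rightarrow> bool"
    and F :: "'i \<Rightarrow> 'g set"
    and H L :: "'g \<Rightarrow> real"
    and C :: "'i \<Rightarrow> 'x \<Rightarrow> 'x set"
    and f fstar :: "'x \<Rightarrow> complex"
  assumes "locally_compact_space (euclidean :: 'g topology)"
    and "unimodular TYPE('g)"
    and "bi_invariant_haar_measure m"
    and "compact_pseudometric_space p"
    and "continuous_action T"
    and "prob_space \<mu>"
    and "regular_borel_measure \<mu>"
    and "directed_preorder le"
    and "\<And>i. compact (F i)"
    and "\<And>i. emeasure m (F i) > 0"
    and "H \<in> borel_measurable borel"
    and "L \<in> borel_measurable borel"
    and "\<And>g. H g > 0"
    and "\<And>g. L g > 0"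
    and "\<And>g x y. p (T g x) (T g y) \<le> L g * p x y powr H g"
    and "\<And>i x. C i x \<in> sets borel"
    and "\<And>i x. x \<in> C i x"
    and "\<And>i x. emeasure \<mu> (C i x) > 0"
    and "AE x in \<mu>. \<forall>\<delta>>0.
           ((\<lambda>i. measure m {g \<in> F i. L g * pdiam p (C i x) powr H g > \<delta>} / measure m (F i))
              \<longlongrightarrow> 0) (net_filter le)"
    and "continuous_on UNIV f"
    and "fstar \<in> borel_measurable borel"
    and "AE x in \<mu>. ((\<lambda>i. Avg m T (F i) f x) \<longlongrightarrow> fstar x) (net_filter le)"
  shows "AE x in \<mu>. ((\<lambda>i. set_mean \<mu> (C i x) (Avg m T (F i) f)) \<longlongrightarrow> fstar x) (net_filter le)"
proof -
  note p = assms(4) and T = assms(5) and H = assms(13) and L = assms(14) and Hoelder = assms(15)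
    and C = assms(16-18) and f = assms(20)
  interpret prob_space \<mu> by fact
  have m: "sets m = sets borel" and m_compact: "\<And>K. compact K \<Longrightarrow> emeasure m K < \<infinity>"
    using assms(3) by (auto simp: bi_invariant_haar_measure_def left_haar_measure_def)
  have \<mu>: "sets \<mu> = sets borel"
    using assms(7) by (simp add: regular_borel_measure_def)
  have p_nonneg: "0 \<le> p x y" for x y
    using p by (auto simp: compact_pseudometric_space_def pseudometric_def)
  \<comment> \<open>Without the Hausdorff property compactness does not give measurability;
    positivity does, because \<open>emeasure\<close> vanishes on non-measurable sets.\<close>
  have F: "F i \<in> sets m" "0 < emeasure m (F i)" "emeasure m (F i) < \<infinity>" for i
    using assms(10)[of i] m_compact[OF assms(9)] emeasure_notin_sets[of "F i" m] by fastforce+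
  have fT: "continuous_on UNIV (\<lambda>(x, g). f (T g x))"
  proof -
    have "continuous_on UNIV (\<lambda>z. (snd z, fst z))"
      by (intro continuous_intros)
    moreover have "continuous_on UNIV (\<lambda>(g, x). T g x)"
      using T by (simp add: continuous_action_def)
    ultimately have "continuous_on UNIV (\<lambda>z. case (snd z, fst z) of (g, x) \<Rightarrow> T g x)"
      using continuous_on_compose2 by blast
    from continuous_on_compose2[OF f this] show ?thesis
      by (simp add: split_beta)
  qed
  obtain K where K: "0 < K" "\<And>x. norm (f x) \<le> K"
  proof -
    have "bounded (range f)"
      using p f by (intro compact_imp_bounded compact_continuous_image)
        (auto simp: compact_pseudometric_space_def)
    then show ?thesis
      using that unfolding bounded_pos by auto
  qed
  have Avg_mean: "Avg m T (F i) f x = set_mean m (F i) (\<lambda>g. f (T g x))" for i x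
    by (simp add: Avg_def set_mean_def)
  have orbit_int: "set_integrable m (F i) (\<lambda>g. f (T g x))" for i x
    by (rule set_integrable_continuous_bounded[OF m F(1,3) _ K(2)])
      (use continuous_on_compose2[OF fT continuous_on_Pair[OF continuous_on_const continuous_on_id]]
        in simp)
  have Avg_cont: "continuous_on UNIV (Avg m T (F i) f)" for i
    using continuous_on_set_mean[OF m F assms(9) fT K(2)] by (simp add: Avg_mean [abs_def])
  \<comment> \<open>The mean is compared with the constant 0.\<close>
  have Avg_bnd: "norm (Avg m T (F i) f x) \<le> K" for i x
    using norm_set_mean_diff_const_le[OF F orbit_int, of i x 0 K] K by (simp add: Avg_mean)
  have Avg_int: "set_integrable \<mu> (C i x) (Avg m T (F i) f)" for i x
    by (rule set_integrable_continuous_bounded[OF \<mu> _ _ Avg_cont Avg_bnd])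
      (use C(1) \<mu> in \<open>auto simp: less_top[symmetric]\<close>)
  \<comment> \<open>This holds at every single \<open>x\<close> satisfying the smallness condition,
    so no null sets depending on \<open>i\<close> arise, however large the index set.\<close>
  have diff: "((\<lambda>i. set_mean \<mu> (C i x) (Avg m T (F i) f) - Avg m T (F i) f x) \<longlongrightarrow> 0) (net_filter le)"
    if small: "\<forall>\<delta>>0.
        ((\<lambda>i. measure m {g \<in> F i. L g * pdiam p (C i x) powr H g > \<delta>} / measure m (F i))
           \<longlongrightarrow> 0) (net_filter le)" for x
  proof (rule tendstoI)
    fix e :: real assume "0 < e"
    then have "0 < e / 4" by simp
    obtain d where d: "0 < d" "\<And>x y. p x y < d \<Longrightarrow> dist (f x) (f y) < e / 4"
      using compact_pseudometric_space_uniformly_continuous[OF p f \<open>0 < e / 4\<close>] by blast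
    \<comment> \<open>The threshold \<open>d / 2\<close> turns the non-strict bound outside
      \<open>B i\<close> into the strict inequality that uniform continuity requires.\<close>
    define B where "B i = {g \<in> F i. L g * pdiam p (C i x) powr H g > d / 2}" for i
    have B: "B i \<in> sets m" for i
    proof -
      \<comment> \<open>With \<open>i\<close> and \<open>x\<close> fixed the diameter is a constant,
        so only measurability of \<open>H\<close> and \<open>L\<close> in \<open>g\<close> is
        involved.\<close>
      have "{g. L g * pdiam p (C i x) powr H g > d / 2} \<in> sets borel"
        using assms(11,12) by measurable
      then have "F i \<inter> {g. L g * pdiam p (C i x) powr H g > d / 2} \<in> sets m"
        using F(1) m by auto
      then show ?thesis by (simp add: B_def Int_def)
    qed
    \<comment> \<open>The constant is chosen so that the bad part costs at most
      \<open>2 * K * (e / (8 * K)) = e / 4\<close>, as much as the good part.\<close>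
    have "\<forall>\<^sub>F i in net_filter le. measure m (B i) / measure m (F i) < e / (8 * K)"
      using order_tendstoD(2)[OF small[rule_format, of "d / 2"], of "e / (8 * K)"] d K \<open>0 < e\<close>
      by (simp add: B_def)
    then show "\<forall>\<^sub>F i in net_filter le.
        dist (set_mean \<mu> (C i x) (Avg m T (F i) f) - Avg m T (F i) f x) 0 < e"
    proof eventually_elim
      case (elim i)
      \<comment> \<open>The index \<open>i\<close> was fixed before \<open>y\<close>, so the bound
        is uniform on \<open>C i x\<close> and survives averaging over it.\<close>
      have "norm (Avg m T (F i) f y - Avg m T (F i) f x) \<le> e / 2" if y: "y \<in> C i x" for y
      proof -
        have good: "norm (f (T g y) - f (T g x)) \<le> e / 4" if g: "g \<in> F i - B i" for g
        proof -
          have "p (T g y) (T g x) \<le> L g * p y x powr H g"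
            by (rule Hoelder)
          \<comment> \<open>Here \<open>H g > 0\<close> makes the power increasing; a zero base is
            covered as well, since \<open>powr\<close> sends it to 0.\<close>
          also have "\<dots> \<le> L g * pdiam p (C i x) powr H g"
            using L[of g] H[of g] p_nonneg dist_le_pdiam[OF p y C(2)]
            by (intro mult_left_mono powr_mono2) auto
          also have "\<dots> < d"
            using g d(1) by (auto simp: B_def)
          finally show ?thesis
            using d(2) by (force simp: dist_norm intro: less_imp_le)
        qed
        have bad: "norm (f (T g y) - f (T g x)) \<le> 2 * K" for g
          using norm_triangle_ineq4[of "f (T g y)" "f (T g x)"] K(2)[of "T g y"] K(2)[of "T g x"]
          by linarith
        have "norm (Avg m T (F i) f y - Avg m T (F i) f x)
            \<le> e / 4 + 2 * K * (measure m (B i) / measure m (F i))"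
          unfolding Avg_mean using F orbit_int B good bad \<open>0 < e\<close>
          by (intro norm_set_mean_diff_le) (auto simp: B_def)
        also have "\<dots> \<le> e / 4 + 2 * K * (e / (8 * K))"
          using elim K(1) by (intro add_left_mono mult_left_mono) auto
        also have "\<dots> = e / 2"
          using K(1) by (simp add: field_simps)
        finally show ?thesis .
      qed
      then have "norm (set_mean \<mu> (C i x) (Avg m T (F i) f) - Avg m T (F i) f x) \<le> e / 2"
        using C \<mu> Avg_int \<open>0 < e\<close>
        by (intro norm_set_mean_diff_const_le) (auto simp: less_top[symmetric])
      then show ?case
        using \<open>0 < e\<close> by simp
    qed
  qed
  \<comment> \<open>Only two null sets are discarded, one for each almost-everywhere
    hypothesis.\<close>
  show ?thesis
    using assms(19,22)
  proof eventually_elim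
    case (elim x)
    from tendsto_add[OF diff[OF elim(1)] elim(2)] show ?case
      by simp
  qed
qed

end
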